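(* The coarse MILP is a relaxation of the semi-coarse MILP (both defined in the context), i.e. both have the same objective function and every feasible point of the semi-coarse MILP is feasible for the coarse MILP. Moreover, the following algorithm terminates after finitely many iterations: solve the coarse MILP; while the current solution violates some row constraint of the semi-coarse MILP, add all row constraints of the semi-coarse MILP violated by it and re-solve the coarse MILP with all constraints added so far.
   Context: All vector inequalities are componentwise. "Solve" means compute an optimal solution; it is assumed that each problem to be solved has one. Original data. Let $m,N,M$ be positive integers, $a\in\mathbb{R}^m$, $b,c,d\in\mathbb{R}^N$, $f\in\mathbb{R}^M$, $A\in\mathbb{R}^{M\times m}$, $B,C,D\in\mathbb{R}^{M\times N}$, and let $L\le U$ be finite real bounds. Let $\delta$ be a positive integer with $N=n\delta$, and suppose the $M$ constraint rows are partitioned into $n$ consecutive groups of size $\delta$ (so $M=n\delta$). Vectors in $\mathbb{R}^N$ are split into $n$ consecutive blocks of length $\delta$ (e.g. $b=(b_1,\dots,b_n)$), and $B=[B_1:\cdots:B_n]$, $C=[C_1:\cdots:C_n]$, $D=[D_1:\cdots:D_n]$ with $B_i,C_i,D_i\in\mathbb{R}^{M\times\delta}$. Profiles. Fixed data: $\bar X_k\in\{0,1\}^\delta$ for $k=1,\dots,K$; for each $k$, vectors $\bar V_{jk}\in\mathbb{R}^\delta$ with $L\bar X_k\le\bar V_{jk}\le U\bar X_k$ for $j=1,\dots,I_k$; and vectors $\bar W_j\in\mathbb{R}^\delta$ with $\bar W_j\ge0$ for $j=1,\dots,J$. Let $\bar X$, $\bar V$, $\bar W$ be the matrices whose columns are,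 respectively, all $\bar X_k$, all $\bar V_{jk}$ (ordered by $k$, then $j$), and all $\bar W_j$. Aggregated data. $\bar B=[B_1\bar X:\cdots:B_n\bar X]$, $\bar C=[C_1\bar V:\cdots:C_n\bar V]$, $\bar D=[D_1\bar W:\cdots:D_n\bar W]$, and $\bar b=[b_1^T\bar X:\cdots:b_n^T\bar X]^T$, $\bar c=[c_1^T\bar V:\cdots:c_n^T\bar V]^T$, $\bar d=[d_1^T\bar W:\cdots:d_n^T\bar W]^T$. The coefficient vectors $\bar x=(\bar x_{ik})$, $\bar v=(\bar v_{ijk})$, $\bar w=(\bar w_{ij})$ are ordered compatibly. Semi-coarse MILP: minimize $a^Ty+\bar b^T\bar x+\bar c^T\bar v+\bar d^T\bar w$ over $(y,\bar x,\bar v,\bar w)$ subject to the $M$ row constraints $Ay+\bar B\bar x+\bar C\bar v+\bar D\bar w\le f$, $y\in\{0,1\}^m$, and for all $i=1,\dots,n$: $\sum_{k=1}^K\bar x_{ik}\le1$, $\bar x_{ik}\in\{0,1\}$; $\sum_{k=1}^K\sum_{j=1}^{I_k}\bar v_{ijk}\le1$, $\sum_{j=1}^{I_k}\bar v_{ijk}=\bar x_{ik}$ for every $k$, $0\le\bar v_{ijk}\le1$; $\sum_{j=1}^J\bar w_{ij}\le1$, $0\le\bar w_{ij}\le1$. Coarse MILP: the same problem, except that the $M$ row constraints are replaced by the $n$ aggregated constraints $\hat Ay+\hat{\bar B}\bar x+\hat{\bar C}\bar v+\hat{\bar D}\bar w\le\hat f$, where a hat denotes summing the rows in each of the $n$ groups: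 the $g$-th row of $\hat A$ is $\sum_{i=1}^\delta A_{\delta(g-1)+i}^T$ (with $A_r^T$ the $r$-th row of $A$), and likewise for $\hat{\bar B},\hat{\bar C},\hat{\bar D},\hat f$. *)

theory Defs
  imports "Jordan_Normal_Form.Matrix"
begin

section \<open>Data\<close>

text \<open>
  All indices are 0-based. \<open>prof_V P k j\<close> is the paper's \<open>V_jk\<close>, and \<open>num_V P k\<close> is \<open>I_k\<close>.
\<close>

record milp_data =
  dim_m :: nat
  dim_N :: nat
  dim_M :: nat
  blocks :: nat
  delta :: nat
  vec_a :: "real vec"
  vec_b :: "real vec"
  vec_c :: "real vec"
  vec_d :: "real vec"
  vec_f :: "real vec"
  mat_A :: "real mat"
  mat_B :: "real mat"
  mat_C :: "real mat"
  mat_D :: "real mat"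
  lower :: real
  upper :: real
  num_X :: nat
  num_V :: "nat \<Rightarrow> nat"
  num_W :: nat
  prof_X :: "nat \<Rightarrow> real vec"
  prof_V :: "nat \<Rightarrow> nat \<Rightarrow> real vec"
  prof_W :: "nat \<Rightarrow> real vec"

definition valid_data :: "milp_data \<Rightarrow> bool" where
  "valid_data P \<longleftrightarrow>
     dim_m P > 0 \<and> dim_N P > 0 \<and> dim_M P > 0 \<and> delta P > 0 \<and>
     dim_N P = blocks P * delta P \<and> dim_M P = blocks P * delta P \<and>
     vec_a P \<in> carrier_vec (dim_m P) \<and>
     vec_b P \<in> carrier_vec (dim_N P) \<and>
     vec_c P \<in> carrier_vec (dim_N P) \<and>
     vec_d P \<in> carrier_vec (dim_N P) \<and>
     vec_f P \<in> carrier_vec (dim_M P) \<and>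
     mat_A P \<in> carrier_mat (dim_M P) (dim_m P) \<and>
     mat_B P \<in> carrier_mat (dim_M P) (dim_N P) \<and>
     mat_C P \<in> carrier_mat (dim_M P) (dim_N P) \<and>
     mat_D P \<in> carrier_mat (dim_M P) (dim_N P) \<and>
     lower P \<le> upper P \<and>
     (\<forall>k<num_X P. prof_X P k \<in> carrier_vec (delta P) \<and>
        (\<forall>t<delta P. prof_X P k $ t \<in> {0, 1})) \<and>
     (\<forall>k<num_X P. \<forall>j<num_V P k. prof_V P k j \<in> carrier_vec (delta P) \<and>
        lower P \<cdot>\<^sub>v prof_X P k \<le> prof_V P k j \<and>
        prof_V P k j \<le> upper P \<cdot>\<^sub>v prof_X P k) \<and>
     (\<forall>j<num_W P. prof_W P j \<in> carrier_vec (delta P) \<and> 0\<^sub>v (delta P) \<le> prof_W P j)"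

definition X_mat :: "milp_data \<Rightarrow> real mat" where
  "X_mat P = mat_of_cols (delta P) (map (prof_X P) [0..<num_X P])"

definition V_mat :: "milp_data \<Rightarrow> real mat" where
  "V_mat P = mat_of_cols (delta P)
     (concat (map (\<lambda>k. map (prof_V P k) [0..<num_V P k]) [0..<num_X P]))"

definition W_mat :: "milp_data \<Rightarrow> real mat" where
  "W_mat P = mat_of_cols (delta P) (map (prof_W P) [0..<num_W P])"


section \<open>Aggregation\<close>

definition vec_block :: "nat \<Rightarrow> real vec \<Rightarrow> nat \<Rightarrow> real vec" where
  "vec_block \<delta> u i = vec \<delta> (\<lambda>t. u $ (i * \<delta> + t))"

definition col_block :: "nat \<Rightarrow> real mat \<Rightarrow> nat \<Rightarrow> real mat" where
  "col_block \<delta> Q i = mat (dim_row Q) \<delta> (\<lambda>(r, t). Q $$ (r, i * \<delta> + t))"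

text \<open>\<open>[Q\<^sub>1 R : \<dots> : Q\<^sub>n R]\<close> for \<open>Q = [Q\<^sub>1 : \<dots> : Q\<^sub>n]\<close>\<close>

definition agg_mat :: "nat \<Rightarrow> nat \<Rightarrow> real mat \<Rightarrow> real mat \<Rightarrow> real mat" where
  "agg_mat n \<delta> Q R =
     mat_of_cols (dim_row Q) (concat (map (\<lambda>i. cols (col_block \<delta> Q i * R)) [0..<n]))"

text \<open>\<open>[u\<^sub>1\<^sup>T R : \<dots> : u\<^sub>n\<^sup>T R]\<^sup>T\<close> for \<open>u = (u\<^sub>1, \<dots>, u\<^sub>n)\<close>\<close>

definition agg_vec :: "nat \<Rightarrow> nat \<Rightarrow> real vec \<Rightarrow> real mat \<Rightarrow> real vec" where
  "agg_vec n \<delta> u R =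
     vec_of_list (concat (map (\<lambda>i. list_of_vec (R\<^sup>T *\<^sub>v vec_block \<delta> u i)) [0..<n]))"

definition B_bar :: "milp_data \<Rightarrow> real mat" where
  "B_bar P = agg_mat (blocks P) (delta P) (mat_B P) (X_mat P)"

definition C_bar :: "milp_data \<Rightarrow> real mat" where
  "C_bar P = agg_mat (blocks P) (delta P) (mat_C P) (V_mat P)"

definition D_bar :: "milp_data \<Rightarrow> real mat" where
  "D_bar P = agg_mat (blocks P) (delta P) (mat_D P) (W_mat P)"

definition b_bar :: "milp_data \<Rightarrow> real vec" where
  "b_bar P = agg_vec (blocks P) (delta P) (vec_b P) (X_mat P)"

definition c_bar :: "milp_data \<Rightarrow> real vec" where
  "c_bar P = agg_vec (blocks P) (delta P) (vec_c P) (V_mat P)"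

definition d_bar :: "milp_data \<Rightarrow> real vec" where
  "d_bar P = agg_vec (blocks P) (delta P) (vec_d P) (W_mat P)"

text \<open>The hat operation: summing the rows in each of \<open>n\<close> consecutive groups of size \<open>\<delta>\<close>.\<close>

definition hat_mat :: "nat \<Rightarrow> nat \<Rightarrow> real mat \<Rightarrow> real mat" where
  "hat_mat n \<delta> Q = mat n (dim_col Q) (\<lambda>(g, s). \<Sum>i<\<delta>. Q $$ (\<delta> * g + i, s))"

definition hat_vec :: "nat \<Rightarrow> nat \<Rightarrow> real vec \<Rightarrow> real vec" where
  "hat_vec n \<delta> u = vec n (\<lambda>g. \<Sum>i<\<delta>. u $ (\<delta> * g + i))"


section \<open>The two MILPs\<close>

record 'p min_problem =
  objective :: "'p \<Rightarrow> real"
  feasible :: "'p set"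

definition optimal :: "'p min_problem \<Rightarrow> 'p \<Rightarrow> bool" where
  "optimal Q p \<longleftrightarrow> is_arg_min (objective Q) (\<lambda>q. q \<in> feasible Q) p"

definition is_relaxation_of :: "'p min_problem \<Rightarrow> 'p min_problem \<Rightarrow> bool" where
  "is_relaxation_of Q Q' \<longleftrightarrow> objective Q = objective Q' \<and> feasible Q' \<subseteq> feasible Q"

definition total_V :: "milp_data \<Rightarrow> nat" where
  "total_V P = (\<Sum>k<num_X P. num_V P k)"

text \<open>
  A point is \<open>(y, x, v, w)\<close>. The three functions below locate the scalar coefficients
  \<open>x_ik\<close>, \<open>v_ijk\<close>, \<open>w_ij\<close> in the order of the columns of \<open>B_bar\<close>, \<open>C_bar\<close>, \<open>D_bar\<close>.
\<close>

type_synonym point = "real vec \<times> real vec \<times> real vec \<times> real vec"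

definition x_coeff :: "milp_data \<Rightarrow> real vec \<Rightarrow> nat \<Rightarrow> nat \<Rightarrow> real" where
  "x_coeff P x i k = x $ (i * num_X P + k)"

definition v_coeff :: "milp_data \<Rightarrow> real vec \<Rightarrow> nat \<Rightarrow> nat \<Rightarrow> nat \<Rightarrow> real" where
  "v_coeff P v i j k = v $ (i * total_V P + (\<Sum>l<k. num_V P l) + j)"

definition w_coeff :: "milp_data \<Rightarrow> real vec \<Rightarrow> nat \<Rightarrow> nat \<Rightarrow> real" where
  "w_coeff P w i j = w $ (i * num_W P + j)"

definition milp_objective :: "milp_data \<Rightarrow> point \<Rightarrow> real" where
  "milp_objective P = (\<lambda>(y, x, v, w).
     vec_a P \<bullet> y + b_bar P \<bullet> x + c_bar P \<bullet> v + d_bar P \<bullet> w)"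

definition profile_constraints :: "milp_data \<Rightarrow> point \<Rightarrow> bool" where
  "profile_constraints P = (\<lambda>(y, x, v, w).
     y \<in> carrier_vec (dim_m P) \<and>
     x \<in> carrier_vec (blocks P * num_X P) \<and>
     v \<in> carrier_vec (blocks P * total_V P) \<and>
     w \<in> carrier_vec (blocks P * num_W P) \<and>
     (\<forall>s<dim_m P. y $ s \<in> {0, 1}) \<and>
     (\<forall>i<blocks P.
        (\<Sum>k<num_X P. x_coeff P x i k) \<le> 1 \<and>
        (\<forall>k<num_X P. x_coeff P x i k \<in> {0, 1}) \<and>
        (\<Sum>k<num_X P. \<Sum>j<num_V P k. v_coeff P v i j k) \<le> 1 \<and>
        (\<forall>k<num_X P. (\<Sum>j<num_V P k. v_coeff P v i j k) = x_coeff P x i k) \<and>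
        (\<forall>k<num_X P. \<forall>j<num_V P k. 0 \<le> v_coeff P v i j k \<and> v_coeff P v i j k \<le> 1) \<and>
        (\<Sum>j<num_W P. w_coeff P w i j) \<le> 1 \<and>
        (\<forall>j<num_W P. 0 \<le> w_coeff P w i j \<and> w_coeff P w i j \<le> 1)))"

definition row_lhs :: "milp_data \<Rightarrow> point \<Rightarrow> real vec" where
  "row_lhs P = (\<lambda>(y, x, v, w).
     mat_A P *\<^sub>v y + B_bar P *\<^sub>v x + C_bar P *\<^sub>v v + D_bar P *\<^sub>v w)"

definition hat_row_lhs :: "milp_data \<Rightarrow> point \<Rightarrow> real vec" where
  "hat_row_lhs P = (\<lambda>(y, x, v, w).
     hat_mat (blocks P) (delta P) (mat_A P) *\<^sub>v y +
     hat_mat (blocks P) (delta P) (B_bar P) *\<^sub>v x +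
     hat_mat (blocks P) (delta P) (C_bar P) *\<^sub>v v +
     hat_mat (blocks P) (delta P) (D_bar P) *\<^sub>v w)"

definition semi_coarse_milp :: "milp_data \<Rightarrow> point min_problem" where
  "semi_coarse_milp P =
     \<lparr>objective = milp_objective P,
      feasible = {p. profile_constraints P p \<and> row_lhs P p \<le> vec_f P}\<rparr>"

definition coarse_milp :: "milp_data \<Rightarrow> point min_problem" where
  "coarse_milp P =
     \<lparr>objective = milp_objective P,
      feasible = {p. profile_constraints P p \<and>
                     hat_row_lhs P p \<le> hat_vec (blocks P) (delta P) (vec_f P)}\<rparr>"


section \<open>The algorithm\<close>

definition coarse_milp_with :: "milp_data \<Rightarrow> nat set \<Rightarrow> point min_problem" where
  "coarse_milp_with P R =
     \<lparr>objective = objective (coarse_milp P),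
      feasible = {p \<in> feasible (coarse_milp P). \<forall>r\<in>R. row_lhs P p $ r \<le> vec_f P $ r}\<rparr>"

definition violated_rows :: "milp_data \<Rightarrow> point \<Rightarrow> nat set" where
  "violated_rows P p = {r. r < dim_M P \<and> \<not> row_lhs P p $ r \<le> vec_f P $ r}"

text \<open>
  A state consists of the indices of the row constraints added so far and the current solution.
  Solving is nondeterministic: any optimal solution may be returned.
\<close>

type_synonym state = "nat set \<times> point"

definition alg_init :: "milp_data \<Rightarrow> state \<Rightarrow> bool" where
  "alg_init P = (\<lambda>(R, p). R = {} \<and> optimal (coarse_milp P) p)"

definition alg_step :: "milp_data \<Rightarrow> state \<Rightarrow> state \<Rightarrow> bool" where
  "alg_step P = (\<lambda>(R, p) (R', p').
     violated_rows P p \<noteq> {} \<and>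
     R' = R \<union> violated_rows P p \<and> optimal (coarse_milp_with P R') p')"

definition alg_reachable :: "milp_data \<Rightarrow> state \<Rightarrow> bool" where
  "alg_reachable P s \<longleftrightarrow> (\<exists>s0. alg_init P s0 \<and> (alg_step P)\<^sup>*\<^sup>* s0 s)"

text \<open>Every problem that the algorithm has to solve in some run has an optimal solution.\<close>

definition alg_problems_solvable :: "milp_data \<Rightarrow> bool" where
  "alg_problems_solvable P \<longleftrightarrow>
     (\<exists>p. optimal (coarse_milp P) p) \<and>
     (\<forall>R p. alg_reachable P (R, p) \<and> violated_rows P p \<noteq> {} \<longrightarrow>
        (\<exists>q. optimal (coarse_milp_with P (R \<union> violated_rows P p)) q))"

text \<open>
  Whatever optimal solutions are returned, no run goes on forever, and a run can only end because
  the loop condition fails, never because a problem to be solved has no optimal solution.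
\<close>

definition alg_terminates :: "milp_data \<Rightarrow> bool" where
  "alg_terminates P \<longleftrightarrow>
     (\<exists>s. alg_init P s) \<and>
     (\<nexists>s :: nat \<Rightarrow> state. alg_init P (s 0) \<and> (\<forall>t. alg_step P (s t) (s (Suc t)))) \<and>
     (\<forall>R p. alg_reachable P (R, p) \<and> (\<nexists>s'. alg_step P (R, p) s') \<longrightarrow> violated_rows P p = {})"

end

theory Submission
  imports Defs
begin

text \<open>
  Each coarse row constraint is the sum of the \<open>\<delta>\<close> semi-coarse row constraints of its group:
  summing the rows of a matrix in groups commutes with applying the matrix to a vector
  (\<open>hat_mat_mult_vec\<close>), so the coarse left-hand side is the hat of the semi-coarse one
  (\<open>hat_row_lhs_eq\<close>).  As summation is monotone, a point that satisfies the semi-coarse rows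
  satisfies the coarse ones, and the remaining constraints and the objectives coincide.

  For termination, a current solution satisfies every row constraint added so far
  (\<open>alg_invariant_step\<close>), so the rows it violates are all new.  Each iteration therefore strictly
  enlarges the set of added rows, which lives inside the \<open>M\<close> available rows; at most \<open>M\<close> iterations
  are possible (\<open>alg_run_card\<close>), whichever optimal solutions are returned.  A run cannot get stuck
  earlier, since every problem it meets is assumed solvable.
\<close>

section \<open>Dimensions of the aggregated matrices\<close>

lemma dim_col_agg_mat: "dim_col (agg_mat n \<delta> Q R) = n * dim_col R"
  by (simp add: agg_mat_def length_concat comp_def sum_list_triv)

lemma dim_row_agg_mat: "dim_row (agg_mat n \<delta> Q R) = dim_row Q"
  by (simp add: agg_mat_def)

lemma dim_col_V_mat: "dim_col (V_mat P) = total_V P"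
  by (simp add: V_mat_def total_V_def length_concat comp_def interv_sum_list_conv_sum_set_nat
      lessThan_atLeast0)

text \<open>
  A matrix-vector product ranges over the entries of the vector, so regrouping the rows of
  \<open>B_bar\<close>, \<open>C_bar\<close>, \<open>D_bar\<close> requires that their column counts match the lengths of the coefficient
  vectors.
\<close>

lemma aggregated_carriers:
  assumes "valid_data P"
  shows "mat_A P \<in> carrier_mat (blocks P * delta P) (dim_m P)"
    and "B_bar P \<in> carrier_mat (blocks P * delta P) (blocks P * num_X P)"
    and "C_bar P \<in> carrier_mat (blocks P * delta P) (blocks P * total_V P)"
    and "D_bar P \<in> carrier_mat (blocks P * delta P) (blocks P * num_W P)"
    and "vec_f P \<in> carrier_vec (blocks P * delta P)"
  using assms
  by (auto simp: valid_data_def B_bar_def C_bar_def D_bar_def dim_col_agg_mat dim_row_agg_mat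
      dim_col_V_mat X_mat_def W_mat_def intro!: carrier_matI)


section \<open>Summing rows in groups\<close>

lemma group_index_less:
  fixes g i n \<delta> :: nat
  assumes "g < n" "i < \<delta>"
  shows "\<delta> * g + i < n * \<delta>"
proof -
  have "\<delta> * g + i < \<delta> * Suc g" using assms by simp
  also have "\<dots> \<le> \<delta> * n" using assms by (intro mult_le_mono2) simp
  finally show ?thesis by (simp add: mult.commute)
qed

lemma hat_mat_mult_vec:
  assumes "Q \<in> carrier_mat (n * \<delta>) k" "u \<in> carrier_vec k"
  shows "hat_mat n \<delta> Q *\<^sub>v u = hat_vec n \<delta> (Q *\<^sub>v u)"
proof (rule eq_vecI)
  fix g assume "g < dim_vec (hat_vec n \<delta> (Q *\<^sub>v u))"
  then have g: "g < n" by (simp add: hat_vec_def)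
  have "(hat_mat n \<delta> Q *\<^sub>v u) $ g = (\<Sum>s<k. (\<Sum>i<\<delta>. Q $$ (\<delta> * g + i, s)) * u $ s)"
    using assms g by (simp add: hat_mat_def scalar_prod_def lessThan_atLeast0)
  also have "\<dots> = (\<Sum>i<\<delta>. \<Sum>s<k. Q $$ (\<delta> * g + i, s) * u $ s)"
    by (subst sum.swap) (simp add: sum_distrib_right)
  also have "\<dots> = (\<Sum>i<\<delta>. (Q *\<^sub>v u) $ (\<delta> * g + i))"
    using assms group_index_less[OF g]
    by (intro sum.cong) (auto simp: scalar_prod_def lessThan_atLeast0)
  finally show "(hat_mat n \<delta> Q *\<^sub>v u) $ g = hat_vec n \<delta> (Q *\<^sub>v u) $ g"
    using g by (simp add: hat_vec_def)
qed (simp add: hat_mat_def hat_vec_def)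

lemma hat_vec_add:
  assumes "u \<in> carrier_vec (n * \<delta>)" "v \<in> carrier_vec (n * \<delta>)"
  shows "hat_vec n \<delta> (u + v) = hat_vec n \<delta> u + hat_vec n \<delta> v"
  using assms by (intro eq_vecI) (auto simp: hat_vec_def group_index_less sum.distrib)

lemma hat_vec_mono:
  assumes "u \<le> v" "v \<in> carrier_vec (n * \<delta>)"
  shows "hat_vec n \<delta> u \<le> hat_vec n \<delta> v"
  using assms by (auto simp: hat_vec_def less_eq_vec_def group_index_less intro!: sum_mono)


section \<open>The relaxation\<close>

lemma hat_row_lhs_eq:
  assumes "valid_data P" "profile_constraints P p"
  shows "hat_row_lhs P p = hat_vec (blocks P) (delta P) (row_lhs P p)"
proof -
  obtain y x v w where p: "p = (y, x, v, w)" by (cases p) auto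
  have u: "y \<in> carrier_vec (dim_m P)" "x \<in> carrier_vec (blocks P * num_X P)"
      "v \<in> carrier_vec (blocks P * total_V P)" "w \<in> carrier_vec (blocks P * num_W P)"
    using assms(2) by (auto simp: profile_constraints_def p)
  note Q = aggregated_carriers(1-4)[OF assms(1)]
  note Qu = Q(1)[THEN mult_mat_vec_carrier, OF u(1)] Q(2)[THEN mult_mat_vec_carrier, OF u(2)]
    Q(3)[THEN mult_mat_vec_carrier, OF u(3)] Q(4)[THEN mult_mat_vec_carrier, OF u(4)]
  show ?thesis
    unfolding p hat_row_lhs_def row_lhs_def prod.case
    by (simp add: hat_mat_mult_vec[OF Q(1) u(1)] hat_mat_mult_vec[OF Q(2) u(2)]
        hat_mat_mult_vec[OF Q(3) u(3)] hat_mat_mult_vec[OF Q(4) u(4)]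
        hat_vec_add Qu add_carrier_vec)
qed

lemma coarse_is_relaxation:
  assumes "valid_data P"
  shows "is_relaxation_of (coarse_milp P) (semi_coarse_milp P)"
  using hat_vec_mono[OF _ aggregated_carriers(5)[OF assms]]
  by (auto simp: is_relaxation_of_def coarse_milp_def semi_coarse_milp_def
      hat_row_lhs_eq[OF assms])


section \<open>Termination of the algorithm\<close>

definition alg_invariant :: "milp_data \<Rightarrow> state \<Rightarrow> bool" where
  "alg_invariant P = (\<lambda>(R, p). R \<subseteq> {..<dim_M P} \<and> R \<inter> violated_rows P p = {})"

lemma alg_invariant_init: "alg_init P s \<Longrightarrow> alg_invariant P s"
  by (auto simp: alg_init_def alg_invariant_def)

text \<open>
  Whatever optimal solution the re-solve returns, it is feasible for the rows added so far.
\<close>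

lemma alg_invariant_step:
  assumes "alg_invariant P s" "alg_step P s s'"
  shows "alg_invariant P s'"
  using assms
  by (auto simp: alg_invariant_def alg_step_def violated_rows_def optimal_def is_arg_min_def
      coarse_milp_with_def)

lemma alg_step_card_less:
  assumes "alg_invariant P s" "alg_step P s s'"
  shows "card (fst s) < card (fst s')"
proof (rule psubset_card_mono)
  have "fst s' \<subseteq> {..<dim_M P}"
    using alg_invariant_step[OF assms] by (auto simp: alg_invariant_def)
  then show "finite (fst s')" by (rule finite_subset) simp
  obtain R p where s: "s = (R, p)" by (cases s)
  have "R \<inter> violated_rows P p = {}" "violated_rows P p \<noteq> {}" "fst s' = R \<union> violated_rows P p"
    using assms by (auto simp: s alg_invariant_def alg_step_def)
  then show "fst s \<subset> fst s'" unfolding s fst_conv by blast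
qed

lemma alg_run_card:
  assumes "alg_init P (s 0)" "\<And>t. alg_step P (s t) (s (Suc t))"
  shows "alg_invariant P (s t) \<and> t \<le> card (fst (s t))"
proof (induction t)
  case 0
  then show ?case by (simp add: alg_invariant_init assms(1))
next
  case (Suc t)
  then show ?case
    using alg_invariant_step[OF _ assms(2)] alg_step_card_less[OF _ assms(2)]
    by (meson Suc_leI le_less_trans)
qed

lemma no_infinite_alg_run:
  "\<not> (alg_init P (s 0) \<and> (\<forall>t. alg_step P (s t) (s (Suc t))))"
proof
  assume "alg_init P (s 0) \<and> (\<forall>t. alg_step P (s t) (s (Suc t)))"
  then have run: "alg_invariant P (s t) \<and> t \<le> card (fst (s t))" for t
    using alg_run_card by blast
  let ?t = "Suc (dim_M P)"
  have "fst (s ?t) \<subseteq> {..<dim_M P}"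
    using run[of ?t] by (auto simp: alg_invariant_def)
  then have "card (fst (s ?t)) \<le> dim_M P"
    using card_mono[of "{..<dim_M P}"] by fastforce
  then show False using run[of ?t] by simp
qed

lemma alg_terminates_if_solvable:
  assumes "alg_problems_solvable P"
  shows "alg_terminates P"
  unfolding alg_terminates_def
proof (intro conjI allI impI)
  show "\<exists>s. alg_init P s"
    using assms by (auto simp: alg_problems_solvable_def alg_init_def)
  show "\<nexists>s. alg_init P (s 0) \<and> (\<forall>t. alg_step P (s t) (s (Suc t)))"
    using no_infinite_alg_run by blast
  show "violated_rows P p = {}"
    if stuck: "alg_reachable P (R, p) \<and> (\<nexists>s'. alg_step P (R, p) s')" for R p
  proof (rule ccontr)
    assume v: "violated_rows P p \<noteq> {}"
    then obtain q where "optimal (coarse_milp_with P (R \<union> violated_rows P p)) q"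
      using stuck assms unfolding alg_problems_solvable_def by blast
    then have "alg_step P (R, p) (R \<union> violated_rows P p, q)"
      using v by (simp add: alg_step_def)
    then show False using stuck by blast
  qed
qed

theorem mainTheorem4:
  fixes P :: milp_data
  assumes "valid_data P"
  shows "is_relaxation_of (coarse_milp P) (semi_coarse_milp P) \<and>
         (alg_problems_solvable P \<longrightarrow> alg_terminates P)"
  using coarse_is_relaxation[OF assms] alg_terminates_if_solvable by blast

end
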